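(* Let $r\colon\mathbb{R}^n\to\mathbb{R}^n$ be defined by $$r(\xi) := A + \tfrac1\alpha \nabla g(\tilde u(\xi)) - \xi,\qquad A := \tfrac12\left(|a_1|^2,\ldots,|a_n|^2\right)^\top .$$ (1) For every $\bar u\in\mathcal{M}(F)$ satisfying the condition $$-\tfrac{2}{\alpha}g'(\bar u)\in\Big\{\psi\in C(F) : \int_D\psi^c\,\mathrm{d}u_d+\int_F\psi\,\mathrm{d}\bar u = W_2^2(u_d,\bar u)\Big\},\qquad(\mathrm{OC})$$ there exists a unique $\bar\xi\in\mathbb{R}^n$ with $\bar u=\tilde u(\bar\xi)$ and $r(\bar\xi)=0$. (2) If $\bar\xi\in\mathbb{R}^n$ with $r(\bar\xi)=0$ is given, then $\bar u:=\tilde u(\bar\xi)$ satisfies (OC). (3) If $g$ is additionally convex, there exists a unique zero $\bar\xi\in\mathbb{R}^n$ of $r$, and it is a minimizer of the problem $\min_{\xi\in\mathbb{R}^n} g(\tilde u(\xi))+\tfrac\alpha2 W_2^2(u_d,\tilde u(\xi))$.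
   Context: $|\cdot|$ is the Euclidean norm. $F=\{a_1,\ldots,a_n\}\subset\mathbb{R}^2$ is a finite set of pairwise distinct points; $D\subset\mathbb{R}^2$ is a convex compact polygon with nonempty interior; $u_d$ is a nonnegative Borel measure on $D$, absolutely continuous w.r.t. the Lebesgue measure, with density $\varrho$ continuous on $D$; $\alpha>0$. $\mathcal{M}(F)$ is the space of signed Borel measures on $F$, identified with $\mathbb{R}^n$ via $v\leftrightarrow\sum_{i=1}^n v_i\delta_{a_i}$. $g\colon\mathcal{M}(F)\to\mathbb{R}$ (equivalently $g\colon\mathbb{R}^n\to\mathbb{R}$) is twice continuously differentiable; $\nabla g$ is its gradient on $\mathbb{R}^n$, and $g'(u)$ is identified with the function in $C(F)$ (functions on $F$) whose value at $a_i$ is the $i$-th component of $\nabla g(u)$. For $u\in\mathcal{M}(F)$, $W_2^2(u_d,u):=\inf\{\int_{D\times F}|x_1-x_2|^2\,\mathrm{d}\gamma(x_1,x_2)\}$, where the infimum is over all nonnegative Borel measures $\gamma$ on $D\times F$ with first marginal $u_d$ and second marginal $u$ ($+\infty$ if there are none). For $\psi\in C(F)$ its $c$-conjugate is $\psi^c(x):=\inf\{c(x,a_i)-\psi(a_i): i=1,\ldots,n\}$, $x\in\mathbb{R}^2$, with $c(x_1,x_2)=|x_1-x_2|^2$. For $\xi\in\mathbb{R}^n$: $D_i(\xi):=\{x\in\operatorname{int}(D): a_i^\top x-\xi_i>a_j^\top x-\xi_j\ \text{for all } j\ne i\}$ and $\tilde u(\xi):=(u_d(D_1(\xi)),\ldots,u_d(D_n(\xi)))^\top\in\mathbb{R}^n\cong\mathcal{M}(F)$.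 *)

theory Defs
  imports "HOL-Analysis.Analysis"
begin

text \<open>
  Throughout, \<open>F = range a\<close> for an injective family \<open>a :: 'n \<Rightarrow> real^2\<close> (so the number of points is
  \<open>CARD('n)\<close>), and the space of signed measures on \<open>F\<close> is identified with \<open>real^'n\<close>.
\<close>

definition gradient :: "(real^'n \<Rightarrow> real) \<Rightarrow> real^'n \<Rightarrow> real^'n" where
  "gradient g x = (THE d. GDERIV g x :> d)"

text \<open>Continuity of the second derivative is continuity of the Hessian matrix.\<close>

definition twice_continuously_differentiable :: "(real^'n \<Rightarrow> real) \<Rightarrow> bool" where
  "twice_continuously_differentiable g \<longleftrightarrow>
     (\<forall>x. g differentiable (at x)) \<and>
     (\<forall>x. gradient g differentiable (at x)) \<and>
     continuous_on UNIV (\<lambda>x. jacobian (gradient g) (at x))"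

definition signed_measure_of :: "('n::finite \<Rightarrow> real^2) \<Rightarrow> real^'n \<Rightarrow> (real^2) set \<Rightarrow> real" where
  "signed_measure_of a v B = (\<Sum>i\<in>UNIV. v $ i * indicator B (a i))"

text \<open>
  Functions on a set \<open>F\<close> are normalised to be \<^term>\<open>undefined\<close> outside \<open>F\<close>.
\<close>

definition C_space :: "(real^2) set \<Rightarrow> (real^2 \<Rightarrow> real) set" where
  "C_space F = {\<psi> \<in> extensional F. continuous_on F \<psi>}"

text \<open>The function on \<open>F\<close> whose value at \<open>a i\<close> is \<open>v $ i\<close>.\<close>

definition fun_of_vec :: "('n::finite \<Rightarrow> real^2) \<Rightarrow> real^'n \<Rightarrow> real^2 \<Rightarrow> real" where
  "fun_of_vec a v = (\<lambda>x\<in>range a. v $ inv a x)"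

definition cost :: "real^2 \<Rightarrow> real^2 \<Rightarrow> real" where
  "cost x y = (norm (x - y))\<^sup>2"

definition c_conj :: "('n::finite \<Rightarrow> real^2) \<Rightarrow> (real^2 \<Rightarrow> real) \<Rightarrow> real^2 \<Rightarrow> real" where
  "c_conj a \<psi> x = (INF i. cost x (a i) - \<psi> (a i))"

text \<open>
  The second marginal is compared in \<^typ>\<open>ereal\<close>, so that there is no coupling when \<open>u\<close> has a
  negative component, and so that an infinite \<open>\<gamma>\<close> is never admitted.
\<close>

definition couplings ::
  "(real^2) set \<Rightarrow> ('n::finite \<Rightarrow> real^2) \<Rightarrow> (real^2) measure \<Rightarrow> real^'n \<Rightarrow> ((real^2) \<times> (real^2)) measure set"
  where
  "couplings D a ud u =
     {\<gamma>. sets \<gamma> = sets (restrict_space borel (D \<times> range a)) \<and>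
          distr \<gamma> (restrict_space borel D) fst = ud \<and>
          (\<forall>B. B \<subseteq> range a \<longrightarrow>
             enn2ereal (emeasure (distr \<gamma> (restrict_space borel (range a)) snd) B)
               = ereal (signed_measure_of a u B))}"

definition W2sq ::
  "(real^2) set \<Rightarrow> ('n::finite \<Rightarrow> real^2) \<Rightarrow> (real^2) measure \<Rightarrow> real^'n \<Rightarrow> ereal" where
  "W2sq D a ud u =
     (INF \<gamma>\<in>couplings D a ud u. enn2ereal (\<integral>\<^sup>+ (x, y). ennreal (cost x y) \<partial>\<gamma>))"

definition kantorovich_potentials ::
  "(real^2) set \<Rightarrow> ('n::finite \<Rightarrow> real^2) \<Rightarrow> (real^2) measure \<Rightarrow> real^'n \<Rightarrow> (real^2 \<Rightarrow> real) set" where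
  "kantorovich_potentials D a ud u =
     {\<psi> \<in> C_space (range a).
        ereal ((\<integral>x. c_conj a \<psi> x \<partial>ud) + (\<Sum>i\<in>UNIV. \<psi> (a i) * u $ i)) = W2sq D a ud u}"

definition OC ::
  "(real^2) set \<Rightarrow> ('n::finite \<Rightarrow> real^2) \<Rightarrow> (real^2) measure \<Rightarrow> real \<Rightarrow> (real^'n \<Rightarrow> real) \<Rightarrow> real^'n \<Rightarrow> bool"
  where
  "OC D a ud \<alpha> g u \<longleftrightarrow>
     fun_of_vec a (- (2 / \<alpha>) *\<^sub>R gradient g u) \<in> kantorovich_potentials D a ud u"

definition cell :: "(real^2) set \<Rightarrow> ('n::finite \<Rightarrow> real^2) \<Rightarrow> real^'n \<Rightarrow> 'n \<Rightarrow> (real^2) set" where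
  "cell D a \<xi> i =
     {x \<in> interior D. \<forall>j. j \<noteq> i \<longrightarrow> a i \<bullet> x - \<xi> $ i > a j \<bullet> x - \<xi> $ j}"

definition u_tilde ::
  "(real^2) set \<Rightarrow> ('n::finite \<Rightarrow> real^2) \<Rightarrow> (real^2) measure \<Rightarrow> real^'n \<Rightarrow> real^'n" where
  "u_tilde D a ud \<xi> = (\<chi> i. measure ud (cell D a \<xi> i))"

definition residual ::
  "(real^2) set \<Rightarrow> ('n::finite \<Rightarrow> real^2) \<Rightarrow> (real^2) measure \<Rightarrow> real \<Rightarrow> (real^'n \<Rightarrow> real)
     \<Rightarrow> real^'n \<Rightarrow> real^'n" where
  "residual D a ud \<alpha> g \<xi> =
     (1 / 2) *\<^sub>R (\<chi> i. (norm (a i))\<^sup>2) + (1 / \<alpha>) *\<^sub>R gradient g (u_tilde D a ud \<xi>) - \<xi>"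

definition objective ::
  "(real^2) set \<Rightarrow> ('n::finite \<Rightarrow> real^2) \<Rightarrow> (real^2) measure \<Rightarrow> real \<Rightarrow> (real^'n \<Rightarrow> real)
     \<Rightarrow> real^'n \<Rightarrow> ereal" where
  "objective D a ud \<alpha> g \<xi> =
     ereal (g (u_tilde D a ud \<xi>)) + ereal (\<alpha> / 2) * W2sq D a ud (u_tilde D a ud \<xi>)"

end

theory Submission
  imports Defs
begin

text \<open>
  Under the substitution \<open>\<psi>\<^sub>i = |a\<^sub>i|\<^sup>2 - 2 \<xi>\<^sub>i\<close> the \<open>c\<close>-conjugate becomes
  \<open>\<psi>\<^sup>c(x) = |x|\<^sup>2 - 2 max\<^sub>i (a\<^sub>i \<bullet> x - \<xi>\<^sub>i)\<close>, and the minimising index at \<open>x\<close> is the one whose cell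
  contains \<open>x\<close>. The equation \<open>r(\<xi>) = 0\<close> says exactly that the potential belonging to \<open>\<xi>\<close> is
  \<open>-(2/\<alpha>) g'(u)\<close> with \<open>u\<close> the vector of cell masses. All three claims are therefore statements about the
  function \<open>G(\<xi>) = \<integral> \<psi>\<^sup>c du\<^sub>d\<close>, which is concave and has the vector of cell masses, doubled, as its
  gradient.

  The concavity inequality \<open>semidual_supergradient\<close> comes from comparing the minimum with the value
  at a fixed index. Almost every point of \<open>D\<close> lies in a cell, because the walls are negligible; by
  dominated convergence the cell masses depend continuously on \<open>\<xi>\<close>. A concave function with a
  continuous supergradient has no other supergradient, which is \<open>supergradient_unique\<close>.

  Weak duality (\<open>weak_duality\<close>) says that \<open>W\<^sub>2\<^sup>2(u\<^sub>d, u)\<close> bounds the dual functional from above, and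
  sending each cell to its point attains equality (\<open>W2sq_u_tilde\<close>), so the cell masses admit the
  potential belonging to \<open>\<xi>\<close> as an optimal one. Conversely, if a potential is optimal for \<open>u\<close>, then
  \<open>\<xi>\<close> maximises the dual functional of \<open>u\<close>, so \<open>2u\<close> is a supergradient of \<open>G\<close> at \<open>\<xi>\<close> and hence \<open>u\<close> is
  the vector of cell masses. The first two claims follow, without an
  optimal coupling for a general \<open>u\<close>.

  A zero of \<open>r\<close> is a fixed point of a continuous map with bounded range, so it exists by Brouwer's
  theorem. For convex \<open>g\<close> two zeros \<open>\<xi>, \<zeta>\<close> satisfy \<open>(\<xi> - \<zeta>) \<bullet> (u(\<xi>) - u(\<zeta>)) \<ge> 0\<close> since \<open>\<nabla>g\<close> is monotone,
  while concavity of \<open>G\<close> gives the opposite inequality; equality makes \<open>2 u(\<xi>)\<close> a supergradient at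
  \<open>\<zeta>\<close> as well, so the masses and then the zeros agree. Finally, the tangent inequality for \<open>g\<close> and
  weak duality with the potential of the zero add up to minimality.
\<close>

section \<open>Gradients\<close>

lemma GDERIV_unique:
  assumes "GDERIV g x :> d" "GDERIV g x :> e"
  shows "d = e"
proof -
  have "(\<lambda>h. h \<bullet> d) = (\<lambda>h. h \<bullet> e)"
    using assms unfolding gderiv_def by (rule has_derivative_unique)
  then have "\<forall>h. h \<bullet> d = h \<bullet> e"
    by (simp add: fun_eq_iff)
  then show ?thesis
    by (rule vector_eq_ldot[THEN iffD1])
qed

lemma GDERIV_gradient:
  fixes g :: "real^'n \<Rightarrow> real"
  assumes "g differentiable (at x)"
  shows "GDERIV g x :> gradient g x"
proof -
  obtain g' where g': "(g has_derivative g') (at x)"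
    using assms unfolding differentiable_def by blast
  then have "linear g'"
    by (rule has_derivative_linear)
  then have "g' = (\<lambda>h. h \<bullet> adjoint g' 1)"
    by (simp add: adjoint_works)
  then have "GDERIV g x :> adjoint g' 1"
    unfolding gderiv_def by (rule has_derivative_eq_rhs[OF g'])
  then show ?thesis
    unfolding gradient_def by (rule theI2) (auto intro: GDERIV_unique \<open>GDERIV g x :> adjoint g' 1\<close>)
qed

text \<open>The one-dimensional tangent inequality on the line through \<open>x\<close> and \<open>y\<close>.\<close>

lemma convex_on_above_gradient:
  fixes g :: "real^'n \<Rightarrow> real"
  assumes cvx: "convex_on UNIV g" and diff: "g differentiable (at x)"
  shows "gradient g x \<bullet> (y - x) \<le> g y - g x"
proof -
  define l where "l t = x + t *\<^sub>R (y - x)" for t :: real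
  have l0: "l 0 = x" and l1: "l 1 = y"
    by (simp_all add: l_def)
  have "convex_on UNIV (\<lambda>t. g (l t))"
  proof (rule convex_onI)
    fix t p q :: real
    assume t: "0 < t" "t < 1"
    have "l ((1 - t) *\<^sub>R p + t *\<^sub>R q) = (1 - t) *\<^sub>R l p + t *\<^sub>R l q"
      unfolding l_def by (simp add: algebra_simps)
    then show "g (l ((1 - t) *\<^sub>R p + t *\<^sub>R q)) \<le> (1 - t) * g (l p) + t * g (l q)"
      using convex_onD[OF cvx, of t "l p" "l q"] t by simp
  qed simp
  moreover have "((\<lambda>t. g (l t)) has_field_derivative (gradient g x \<bullet> (y - x))) (at 0)"
  proof -
    have "(l has_derivative (\<lambda>t. t *\<^sub>R (y - x))) (at 0)"
      unfolding l_def by (auto intro!: derivative_eq_intros)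
    moreover have "(g has_derivative (\<lambda>h. h \<bullet> gradient g x)) (at (l 0))"
      using GDERIV_gradient[OF diff] unfolding gderiv_def l0 .
    ultimately have "((\<lambda>t. g (l t)) has_derivative (\<lambda>t. (t *\<^sub>R (y - x)) \<bullet> gradient g x)) (at 0)"
      by (rule has_derivative_compose)
    then show ?thesis
      unfolding has_field_derivative_def
      by (rule has_derivative_eq_rhs) (auto simp: inner_commute mult.commute)
  qed
  ultimately have "g (l 1) - g (l 0) \<ge> (gradient g x \<bullet> (y - x)) * (1 - 0)"
    by (intro convex_on_imp_above_tangent[of UNIV]) auto
  then show ?thesis
    by (simp add: l0 l1)
qed

section \<open>Conjugates and cells\<close>

text \<open>The substitution that turns the minimisation in the \<open>c\<close>-conjugate into the comparison of affine
  functions that defines the cells.\<close>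

definition potential :: "('n::finite \<Rightarrow> real^2) \<Rightarrow> real^'n \<Rightarrow> real^'n" where
  "potential a \<xi> = (\<chi> i. (norm (a i))\<^sup>2 - 2 * \<xi> $ i)"

definition semidual :: "('n::finite \<Rightarrow> real^2) \<Rightarrow> (real^2) measure \<Rightarrow> real^'n \<Rightarrow> real" where
  "semidual a ud \<xi> = (\<integral>x. c_conj a (fun_of_vec a (potential a \<xi>)) x \<partial>ud)"

lemma fun_of_vec_apply: "inj a \<Longrightarrow> fun_of_vec a v (a i) = v $ i"
  by (simp add: fun_of_vec_def)

lemma fun_of_vec_C_space: "fun_of_vec a v \<in> C_space (range a)"
  unfolding C_space_def fun_of_vec_def
  by (auto intro: continuous_on_finite)

lemma cost_minus_potential:
  "cost x (a i) - potential a \<xi> $ i = (norm x)\<^sup>2 - 2 * (a i \<bullet> x - \<xi> $ i)"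
  unfolding cost_def potential_def
  by (simp add: power2_norm_eq_inner inner_diff inner_commute)

lemma c_conj_le: "inj a \<Longrightarrow> c_conj a (fun_of_vec a v) x \<le> cost x (a i) - v $ i"
  unfolding c_conj_def
  by (rule cINF_lower2[of _ _ i]) (auto simp: fun_of_vec_apply)

lemma c_conj_attained:
  assumes "inj a"
  obtains i where "c_conj a (fun_of_vec a v) x = cost x (a i) - v $ i"
proof -
  let ?S = "range (\<lambda>i. cost x (a i) - fun_of_vec a v (a i))"
  have "Inf ?S \<in> ?S"
    by (simp add: cInf_eq_Min)
  with that assms show ?thesis
    unfolding c_conj_def by (force simp: fun_of_vec_apply)
qed

lemma c_conj_on_cell:
  assumes "inj a" "x \<in> cell D a \<xi> i"
  shows "c_conj a (fun_of_vec a (potential a \<xi>)) x = cost x (a i) - potential a \<xi> $ i"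
proof (rule antisym)
  show "c_conj a (fun_of_vec a (potential a \<xi>)) x \<le> cost x (a i) - potential a \<xi> $ i"
    using assms(1) by (rule c_conj_le)
next
  obtain j where j: "c_conj a (fun_of_vec a (potential a \<xi>)) x = cost x (a j) - potential a \<xi> $ j"
    using assms(1) by (rule c_conj_attained)
  have "a j \<bullet> x - \<xi> $ j \<le> a i \<bullet> x - \<xi> $ i"
    using assms(2) by (cases "j = i") (auto simp: cell_def intro: less_imp_le)
  then show "cost x (a i) - potential a \<xi> $ i \<le> c_conj a (fun_of_vec a (potential a \<xi>)) x"
    unfolding j cost_minus_potential by simp
qed

lemma cell_unique: "x \<in> cell D a \<xi> i \<Longrightarrow> x \<in> cell D a \<xi> j \<Longrightarrow> i = j"
  unfolding cell_def by (auto dest: less_asym)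

lemma cell_subset: "cell D a \<xi> i \<subseteq> D"
  unfolding cell_def using interior_subset by blast

lemma open_cell:
  fixes a :: "'n::finite \<Rightarrow> real^2"
  shows "open (cell D a \<xi> i)"
proof -
  have "cell D a \<xi> i = interior D \<inter> (\<Inter>j\<in>- {i}. {x. a j \<bullet> x - \<xi> $ j < a i \<bullet> x - \<xi> $ i})"
    by (auto simp: cell_def)
  also have "open \<dots>"
    by (intro open_Int open_interior open_INT ballI open_Collect_less continuous_intros) simp
  finally show ?thesis .
qed

lemma sum_indicator_cell:
  fixes a :: "'n::finite \<Rightarrow> real^2" and f :: "'n \<Rightarrow> real"
  assumes "x \<in> cell D a \<xi> i"
  shows "(\<Sum>j\<in>UNIV. f j * indicator (cell D a \<xi> j) x) = f i"
proof -
  have "(\<Sum>j\<in>UNIV. f j * indicator (cell D a \<xi> j) x) = (\<Sum>j\<in>UNIV. if j = i then f j else 0)"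
    by (rule sum.cong) (use assms cell_unique in \<open>fastforce simp: indicator_def\<close>)+
  then show ?thesis
    by simp
qed

section \<open>The semidual functional and its supergradient\<close>

text \<open>The density of \<open>u\<^sub>d\<close> enters through finiteness of the measure, which makes integrals over the
  compact set \<open>D\<close> finite, and through absolute continuity, which makes the walls between cells null
  sets.\<close>

locale semidiscrete =
  finite_measure ud for ud :: "(real^2) measure" +
  fixes a :: "'n::finite \<Rightarrow> real^2" and D :: "(real^2) set"
  assumes inj: "inj a"
    and compact: "compact D"
    and convex: "convex D"
    and sets_ud: "sets ud = sets (restrict_space borel D)"
    and absolutely_continuous: "\<And>N. negligible N \<Longrightarrow> AE x in ud. x \<notin> N"
begin

abbreviation "pot_conj \<xi> \<equiv> c_conj a (fun_of_vec a (potential a \<xi>))"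
abbreviation "mass \<equiv> u_tilde D a ud"

lemma D_borel [measurable]: "D \<in> sets borel"
  using compact by (simp add: borel_compact)

lemma space_ud: "space ud = D"
  using sets_eq_imp_space_eq[OF sets_ud] by (simp add: space_restrict_space)

lemma measurable_ud: "f \<in> borel_measurable borel \<Longrightarrow> f \<in> borel_measurable ud"
  using measurable_restrict_space1 measurable_cong_sets[OF sets_ud refl] by blast

lemma cell_sets [measurable]: "cell D a \<xi> i \<in> sets ud"
  unfolding sets_ud
  by (subst sets_restrict_space_iff) (auto intro: subsetD[OF cell_subset] open_cell borel_open)

lemma cost_measurable [measurable]: "(\<lambda>x. cost x y) \<in> borel_measurable ud"
  by (rule measurable_ud) (simp add: cost_def)

lemma conj_measurable [measurable]: "c_conj a \<psi> \<in> borel_measurable ud"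
proof -
  have "c_conj a \<psi> = (\<lambda>x. INF i. cost x (a i) - \<psi> (a i))"
    by (rule ext) (simp add: c_conj_def)
  then show ?thesis
    by simp
qed

lemma cost_integrable: "integrable ud (\<lambda>x. cost x y)"
proof -
  have "compact ((\<lambda>x. cost x y) ` D)"
    unfolding cost_def
    by (intro compact_continuous_image compact continuous_intros)
  then obtain B where "\<And>x. x \<in> D \<Longrightarrow> norm (cost x y) \<le> B"
    using compact_imp_bounded[of "(\<lambda>x. cost x y) ` D"] unfolding bounded_iff by blast
  then show ?thesis
    by (intro integrable_const_bound[where B = B] AE_I2) (auto simp: space_ud)
qed

lemma conj_integrable: "integrable ud (pot_conj \<xi>)"
proof (rule Bochner_Integration.integrable_bound)
  show "integrable ud (\<lambda>x. \<Sum>i\<in>UNIV. \<bar>cost x (a i) - potential a \<xi> $ i\<bar>)"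
    by (intro Bochner_Integration.integrable_sum integrable_abs Bochner_Integration.integrable_diff
        cost_integrable) simp
  show "AE x in ud. norm (pot_conj \<xi> x) \<le> norm (\<Sum>i\<in>UNIV. \<bar>cost x (a i) - potential a \<xi> $ i\<bar>)"
  proof (rule AE_I2)
    fix x
    obtain i where i: "pot_conj \<xi> x = cost x (a i) - potential a \<xi> $ i"
      using inj by (rule c_conj_attained)
    have "\<bar>cost x (a i) - potential a \<xi> $ i\<bar> \<le> (\<Sum>i\<in>UNIV. \<bar>cost x (a i) - potential a \<xi> $ i\<bar>)"
      by (rule member_le_sum) auto
    then show "norm (pot_conj \<xi> x) \<le> norm (\<Sum>i\<in>UNIV. \<bar>cost x (a i) - potential a \<xi> $ i\<bar>)"
      unfolding i real_norm_def by linarith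
  qed
qed simp

text \<open>Outside the cells a point lies on the boundary of \<open>D\<close> or on one of the finitely many lines on
  which two of the affine functions agree; distinctness of the points makes these proper lines.\<close>

lemma AE_in_cell: "AE x in ud. \<exists>i. x \<in> cell D a \<xi> i"
proof -
  have "AE x in ud. x \<notin> frontier D"
    by (intro absolutely_continuous negligible_convex_frontier convex)
  moreover have "AE x in ud. \<forall>i j. i \<noteq> j \<longrightarrow> a i \<bullet> x - \<xi> $ i \<noteq> a j \<bullet> x - \<xi> $ j"
  proof (subst AE_all_countable, rule allI, subst AE_all_countable, rule allI)
    fix i j
    show "AE x in ud. i \<noteq> j \<longrightarrow> a i \<bullet> x - \<xi> $ i \<noteq> a j \<bullet> x - \<xi> $ j"
    proof (cases "i = j")
      case False
      then have "a i - a j \<noteq> 0"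
        using inj by (auto dest: injD)
      then have "negligible {x. (a i - a j) \<bullet> x = \<xi> $ i - \<xi> $ j}"
        by (intro negligible_hyperplane) simp
      from absolutely_continuous[OF this] show ?thesis
        by eventually_elim (auto simp: inner_diff_left algebra_simps)
    qed simp
  qed
  moreover have "AE x in ud. x \<in> D"
    by (rule AE_I2) (simp add: space_ud)
  ultimately show ?thesis
  proof eventually_elim
    case (elim x)
    have x: "x \<in> interior D"
      using elim by (auto simp: frontier_def closure_closed compact_imp_closed compact)
    let ?f = "\<lambda>i. a i \<bullet> x - \<xi> $ i"
    have "Max (range ?f) \<in> range ?f"
      by (rule Max_in) auto
    then obtain i where i: "Max (range ?f) = ?f i"
      by (rule imageE)
    have "?f j < ?f i" if "j \<noteq> i" for j
    proof (rule order.not_eq_order_implies_strict)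
      show "?f j \<noteq> ?f i"
        using elim(2) that by simp
      show "?f j \<le> ?f i"
        unfolding i[symmetric] by (rule Max_ge) auto
    qed
    with x show ?case
      unfolding cell_def by blast
  qed
qed

lemma integral_sum_indicator_cell:
  "integrable ud (\<lambda>x. \<Sum>i\<in>UNIV. f i * indicator (cell D a \<xi> i) x)" (is ?int)
  "(\<integral>x. (\<Sum>i\<in>UNIV. f i * indicator (cell D a \<xi> i) x) \<partial>ud) = (\<Sum>i\<in>UNIV. f i * mass \<xi> $ i)" (is ?eq)
proof -
  have ind: "integrable ud (\<lambda>x. f i * indicator (cell D a \<xi> i) x)" for i
    by (simp add: less_top[symmetric])
  show ?int
    by (intro Bochner_Integration.integrable_sum ind)
  show ?eq
    unfolding Bochner_Integration.integral_sum[OF ind] by (simp add: u_tilde_def)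
qed

text \<open>On the cell of index \<open>i\<close> for \<open>\<zeta>\<close> the conjugate for \<open>\<zeta>\<close> is the \<open>i\<close>-th term of a minimum, and the
  conjugate for \<open>\<xi>\<close> is at most the corresponding term.\<close>

lemma semidual_supergradient: "semidual a ud \<xi> \<le> semidual a ud \<zeta> + 2 * ((\<xi> - \<zeta>) \<bullet> mass \<zeta>)"
proof -
  let ?f = "\<lambda>i. 2 * (\<xi> - \<zeta>) $ i"
  have "semidual a ud \<xi>
      \<le> (\<integral>x. pot_conj \<zeta> x + (\<Sum>i\<in>UNIV. ?f i * indicator (cell D a \<zeta> i) x) \<partial>ud)"
    unfolding semidual_def
  proof (rule integral_mono_AE)
    show "AE x in ud. pot_conj \<xi> x \<le> pot_conj \<zeta> x + (\<Sum>i\<in>UNIV. ?f i * indicator (cell D a \<zeta> i) x)"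
      using AE_in_cell[of \<zeta>]
    proof eventually_elim
      case (elim x)
      then obtain i where i: "x \<in> cell D a \<zeta> i"
        by blast
      have "pot_conj \<xi> x \<le> cost x (a i) - potential a \<xi> $ i"
        using inj by (rule c_conj_le)
      then show ?case
        unfolding sum_indicator_cell[OF i] c_conj_on_cell[OF inj i]
        by (simp add: potential_def)
    qed
  qed (intro conj_integrable Bochner_Integration.integrable_add integral_sum_indicator_cell)+
  also have "\<dots> = semidual a ud \<zeta> + (\<Sum>i\<in>UNIV. ?f i * mass \<zeta> $ i)"
    unfolding semidual_def
    unfolding Bochner_Integration.integral_add[OF conj_integrable integral_sum_indicator_cell(1)]
      integral_sum_indicator_cell(2) ..
  also have "(\<Sum>i\<in>UNIV. ?f i * mass \<zeta> $ i) = 2 * ((\<xi> - \<zeta>) \<bullet> mass \<zeta>)"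
    by (simp add: inner_vec_def sum_distrib_left mult.assoc[symmetric] right_diff_distrib)
  finally show ?thesis .
qed

text \<open>A point of a cell stays in it under small changes of \<open>\<xi>\<close>, since membership consists of finitely
  many strict inequalities. As almost every point lies in some cell, the indicator of each cell
  converges almost everywhere.\<close>

lemma continuous_mass: "continuous_on UNIV mass"
proof -
  have "(\<lambda>k. measure ud (cell D a (X k) i)) \<longlonglongrightarrow> measure ud (cell D a \<xi> i)"
    if X: "X \<longlonglongrightarrow> \<xi>" for X \<xi> i
  proof -
    have "(\<lambda>k. (\<integral>x. indicator (cell D a (X k) i) x \<partial>ud) :: real)
        \<longlonglongrightarrow> (\<integral>x. indicator (cell D a \<xi> i) x \<partial>ud)"
    proof (rule integral_dominated_convergence)
      show "AE x in ud. (\<lambda>k. indicator (cell D a (X k) i) x :: real) \<longlonglongrightarrow> indicator (cell D a \<xi> i) x"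
        using AE_in_cell[of \<xi>]
      proof eventually_elim
        case (elim x)
        then obtain j where j: "x \<in> cell D a \<xi> j"
          by blast
        have "\<forall>\<^sub>F k in sequentially. a l \<bullet> x - X k $ l < a j \<bullet> x - X k $ j" if "l \<noteq> j" for l
        proof -
          have "(\<lambda>k. (a j \<bullet> x - X k $ j) - (a l \<bullet> x - X k $ l))
              \<longlonglongrightarrow> (a j \<bullet> x - \<xi> $ j) - (a l \<bullet> x - \<xi> $ l)"
            by (intro tendsto_intros X)
          moreover have "0 < (a j \<bullet> x - \<xi> $ j) - (a l \<bullet> x - \<xi> $ l)"
            using j that by (auto simp: cell_def)
          ultimately have "\<forall>\<^sub>F k in sequentially. 0 < (a j \<bullet> x - X k $ j) - (a l \<bullet> x - X k $ l)"
            by (rule order_tendstoD)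
          then show ?thesis
            by eventually_elim simp
        qed
        then have "\<forall>\<^sub>F k in sequentially. \<forall>l\<in>UNIV. l \<noteq> j \<longrightarrow> a l \<bullet> x - X k $ l < a j \<bullet> x - X k $ j"
          by (intro eventually_ball_finite) auto
        then have "\<forall>\<^sub>F k in sequentially. x \<in> cell D a (X k) j"
          by eventually_elim (use j in \<open>auto simp: cell_def\<close>)
        then have "\<forall>\<^sub>F k in sequentially.
            indicator (cell D a (X k) i) x = (indicator (cell D a \<xi> i) x :: real)"
        proof eventually_elim
          case (elim k)
          then have "x \<in> cell D a (X k) i \<longleftrightarrow> x \<in> cell D a \<xi> i"
            using j cell_unique[of x D a _ i j] by blast
          then show ?case
            by (simp add: indicator_def)
        qed
        then show ?case
          by (rule tendsto_eventually)
      qed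
      show "integrable ud (\<lambda>x. 1 :: real)"
        by simp
    qed (auto simp: indicator_def)
    then show ?thesis
      by simp
  qed
  then show ?thesis
    unfolding continuous_on_sequentially comp_def u_tilde_def
    by (auto intro!: vec_tendstoI)
qed

text \<open>Moving from \<open>\<xi>\<close> along a coordinate axis, a supergradient at \<open>\<xi>\<close> and the supergradient at the
  displaced point bound the increment of the semidual from both sides; the displacement then tends
  to zero from either side.\<close>

lemma supergradient_unique:
  assumes u: "\<And>\<zeta>. semidual a ud \<zeta> \<le> semidual a ud \<xi> + 2 * ((\<zeta> - \<xi>) \<bullet> u)"
  shows "u = mass \<xi>"
proof (rule vec_eq_iff[THEN iffD2], rule allI)
  fix i
  let ?m = "\<lambda>t. mass (\<xi> + t *\<^sub>R axis i 1) $ i"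
  have cmp: "t * ?m t \<le> t * u $ i" for t
  proof -
    let ?z = "\<xi> + t *\<^sub>R axis i 1"
    have "semidual a ud \<xi> \<le> semidual a ud ?z + 2 * ((\<xi> - ?z) \<bullet> mass ?z)"
      by (rule semidual_supergradient)
    moreover have "semidual a ud ?z \<le> semidual a ud \<xi> + 2 * ((?z - \<xi>) \<bullet> u)"
      by (rule u)
    ultimately show ?thesis
      by (simp add: inner_axis')
  qed
  have lim: "(?m \<longlongrightarrow> mass \<xi> $ i) (at 0)"
  proof -
    have "isCont (\<lambda>t. mass (\<xi> + t *\<^sub>R axis i 1)) 0"
      by (rule continuous_on_interior[of UNIV])
        (auto intro!: continuous_on_compose2[OF continuous_mass] continuous_intros)
    then show ?thesis
      unfolding isCont_def by (intro tendsto_vec_nth) simp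
  qed
  have "mass \<xi> $ i \<le> u $ i"
  proof (rule tendsto_upperbound)
    show "(?m \<longlongrightarrow> mass \<xi> $ i) (at_right 0)"
      using lim by (rule filterlim_mono[OF _ order_refl]) (simp add: at_le)
    show "\<forall>\<^sub>F t in at_right 0. ?m t \<le> u $ i"
      using eventually_at_right_less
    proof eventually_elim
      case (elim t)
      then show ?case
        using cmp[of t] by simp
    qed
  qed simp
  moreover have "u $ i \<le> mass \<xi> $ i"
  proof (rule tendsto_lowerbound)
    show "(?m \<longlongrightarrow> mass \<xi> $ i) (at_left 0)"
      using lim by (rule filterlim_mono[OF _ order_refl]) (simp add: at_le)
    have "\<forall>\<^sub>F t :: real in at_left 0. t < 0"
      by (simp add: eventually_at_filter)
    then show "\<forall>\<^sub>F t in at_left 0. u $ i \<le> ?m t"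
    proof eventually_elim
      case (elim t)
      then show ?case
        using cmp[of t] by simp
    qed
  qed simp
  ultimately show "u $ i = mass \<xi> $ i"
    by simp
qed

text \<open>Concavity of the semidual yields the inequality opposite to the assumption. So the supergradient
  inequalities between \<open>\<xi>\<close> and \<open>\<zeta>\<close> are tight, and \<open>2 mass \<xi>\<close> is a supergradient at \<open>\<zeta>\<close> too.\<close>

lemma mass_eq_if_monotone:
  assumes "0 \<le> (\<xi> - \<zeta>) \<bullet> (mass \<xi> - mass \<zeta>)"
  shows "mass \<xi> = mass \<zeta>"
proof (rule supergradient_unique)
  fix \<eta>
  have "(\<xi> - \<zeta>) \<bullet> mass \<zeta> \<le> (\<xi> - \<zeta>) \<bullet> mass \<xi>"
    using assms by (simp add: inner_diff_right)
  then have "semidual a ud \<xi> + 2 * ((\<zeta> - \<xi>) \<bullet> mass \<xi>) \<le> semidual a ud \<zeta>"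
    using semidual_supergradient[of \<xi> \<zeta>] by (simp add: inner_diff_left)
  moreover have "semidual a ud \<eta> \<le> semidual a ud \<xi> + 2 * ((\<eta> - \<xi>) \<bullet> mass \<xi>)"
    by (rule semidual_supergradient)
  ultimately show "semidual a ud \<eta> \<le> semidual a ud \<zeta> + 2 * ((\<eta> - \<zeta>) \<bullet> mass \<xi>)"
    by (simp add: inner_diff_left algebra_simps)
qed

section \<open>Duality\<close>

text \<open>The inequality \<open>\<psi>\<^sup>c(x) + \<psi>(y) \<le> c(x, y)\<close> is integrated against a coupling; the integral of its
  left-hand side depends only on the marginals.\<close>

lemma weak_duality: "ereal (semidual a ud \<xi> + potential a \<xi> \<bullet> u) \<le> W2sq D a ud u"
  unfolding W2sq_def
proof (rule INF_greatest)
  fix \<gamma>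
  assume \<gamma>: "\<gamma> \<in> couplings D a ud u"
  have sets_\<gamma>: "sets \<gamma> = sets (restrict_space borel (D \<times> range a))"
    and fst_marg: "distr \<gamma> (restrict_space borel D) fst = ud"
    and snd_marg: "\<And>B. B \<subseteq> range a \<Longrightarrow>
      enn2ereal (emeasure (distr \<gamma> (restrict_space borel (range a)) snd) B) = ereal (signed_measure_of a u B)"
    using \<gamma> by (auto simp: couplings_def)
  have space_\<gamma>: "space \<gamma> = D \<times> range a"
    using sets_eq_imp_space_eq[OF sets_\<gamma>] by (simp add: space_restrict_space)
  have meas_\<gamma>: "f \<in> borel_measurable \<gamma>" if "f \<in> borel_measurable borel"
    for f :: "_ \<Rightarrow> 'z::topological_space"
    using that measurable_restrict_space1 measurable_cong_sets[OF sets_\<gamma> refl] by blast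
  have fst_meas: "fst \<in> \<gamma> \<rightarrow>\<^sub>M restrict_space borel D"
    by (rule measurable_restrict_space2)
      (auto simp: space_\<gamma> intro!: meas_\<gamma> borel_measurable_continuous_onI continuous_intros)
  have snd_meas: "snd \<in> \<gamma> \<rightarrow>\<^sub>M restrict_space borel (range a)"
    by (rule measurable_restrict_space2)
      (auto simp: space_\<gamma> intro!: meas_\<gamma> borel_measurable_continuous_onI continuous_intros)
  interpret \<gamma>: finite_measure \<gamma>
  proof
    have "emeasure \<gamma> (space \<gamma>) = emeasure (distr \<gamma> (restrict_space borel D) fst) D"
      by (subst emeasure_distr[OF fst_meas])
        (auto simp: space_\<gamma> sets_restrict_space_iff intro!: arg_cong[where f = "emeasure \<gamma>"])
    then show "emeasure \<gamma> (space \<gamma>) \<noteq> \<infinity>"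
      unfolding fst_marg by simp
  qed
  define P where "P i = {z \<in> space \<gamma>. snd z = a i}" for i
  have P_vimage: "P i = snd -` {a i} \<inter> space \<gamma>" for i
    by (auto simp: P_def)
  have singleton: "{a i} \<in> sets (restrict_space borel (range a))" for i
    by (subst sets_restrict_space_iff) (auto intro!: borel_closed[OF finite_imp_closed])
  have P_sets [measurable]: "P i \<in> sets \<gamma>" for i
    unfolding P_vimage by (rule measurable_sets[OF snd_meas singleton])
  have P_mass: "measure \<gamma> (P i) = u $ i" for i
  proof -
    have "(\<Sum>j\<in>UNIV. u $ j * indicator {a i} (a j)) = (\<Sum>j\<in>UNIV. if j = i then u $ j else 0)"
      by (rule sum.cong) (use inj in \<open>auto simp: indicator_def dest: injD\<close>)
    then have "signed_measure_of a u {a i} = u $ i"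
      by (simp add: signed_measure_of_def)
    then have "enn2ereal (emeasure \<gamma> (P i)) = ereal (u $ i)"
      using snd_marg[of "{a i}"] unfolding P_vimage
      by (simp add: emeasure_distr[OF snd_meas singleton])
    then show ?thesis
      by (simp add: measure_def enn2real_def)
  qed
  have conj_meas: "pot_conj \<xi> \<in> borel_measurable (restrict_space borel D)"
    using conj_measurable measurable_cong_sets[OF sets_ud refl] by blast
  have int1: "integrable \<gamma> (\<lambda>z. pot_conj \<xi> (fst z))"
    using integrable_distr_eq[OF fst_meas conj_meas] conj_integrable[of \<xi>] unfolding fst_marg by simp
  have eq1: "(\<integral>z. pot_conj \<xi> (fst z) \<partial>\<gamma>) = semidual a ud \<xi>"
    using integral_distr[OF fst_meas conj_meas] unfolding fst_marg semidual_def by (rule sym)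
  have int2': "integrable \<gamma> (\<lambda>z. potential a \<xi> $ i * indicator (P i) z)" for i
    by (simp add: less_top[symmetric])
  have int2: "integrable \<gamma> (\<lambda>z. \<Sum>i\<in>UNIV. potential a \<xi> $ i * indicator (P i) z)"
    by (intro Bochner_Integration.integrable_sum int2')
  have eq2: "(\<integral>z. (\<Sum>i\<in>UNIV. potential a \<xi> $ i * indicator (P i) z) \<partial>\<gamma>) = potential a \<xi> \<bullet> u"
    unfolding Bochner_Integration.integral_sum[OF int2'] by (simp add: P_mass inner_vec_def)
  let ?c = "\<lambda>z. cost (fst z) (snd z)"
  have c_meas: "?c \<in> borel_measurable \<gamma>"
    unfolding cost_def
    by (intro meas_\<gamma> borel_measurable_continuous_onI continuous_intros)
  have le: "pot_conj \<xi> (fst z) + (\<Sum>i\<in>UNIV. potential a \<xi> $ i * indicator (P i) z) \<le> ?c z"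
    if z: "z \<in> space \<gamma>" for z
  proof -
    obtain i where i: "snd z = a i"
      using z by (auto simp: space_\<gamma>)
    have "(\<Sum>j\<in>UNIV. potential a \<xi> $ j * indicator (P j) z)
        = (\<Sum>j\<in>UNIV. if j = i then potential a \<xi> $ j else 0)"
      by (rule sum.cong) (use inj z i in \<open>auto simp: P_def indicator_def dest: injD\<close>)
    then have "(\<Sum>j\<in>UNIV. potential a \<xi> $ j * indicator (P j) z) = potential a \<xi> $ i"
      by simp
    then show ?thesis
      using c_conj_le[OF inj, of "potential a \<xi>" "fst z" i] i by simp
  qed
  have "ereal (semidual a ud \<xi> + potential a \<xi> \<bullet> u) \<le> enn2ereal (\<integral>\<^sup>+z. ennreal (?c z) \<partial>\<gamma>)"
  proof (cases "(\<integral>\<^sup>+z. ennreal (?c z) \<partial>\<gamma>) = \<infinity>")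
    case False
    have int: "integrable \<gamma> ?c"
      using c_meas False
      by (intro integrableI_nonneg) (auto simp: cost_def less_top[symmetric])
    have "semidual a ud \<xi> + potential a \<xi> \<bullet> u
        = (\<integral>z. pot_conj \<xi> (fst z) + (\<Sum>i\<in>UNIV. potential a \<xi> $ i * indicator (P i) z) \<partial>\<gamma>)"
      unfolding Bochner_Integration.integral_add[OF int1 int2] eq1 eq2 ..
    also have "\<dots> \<le> (\<integral>z. ?c z \<partial>\<gamma>)"
      by (rule integral_mono[OF Bochner_Integration.integrable_add[OF int1 int2] int le])
    finally have "ereal (semidual a ud \<xi> + potential a \<xi> \<bullet> u) \<le> ereal (\<integral>z. ?c z \<partial>\<gamma>)"
      by simp
    also have "\<dots> = enn2ereal (ennreal (\<integral>z. ?c z \<partial>\<gamma>))"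
      by (subst enn2ereal_ennreal) (auto intro!: Bochner_Integration.integral_nonneg simp: cost_def)
    also have "ennreal (\<integral>z. ?c z \<partial>\<gamma>) = (\<integral>\<^sup>+z. ennreal (?c z) \<partial>\<gamma>)"
      by (rule nn_integral_eq_integral[symmetric, OF int]) (simp add: cost_def)
    finally show ?thesis .
  qed simp
  then show "ereal (semidual a ud \<xi> + potential a \<xi> \<bullet> u)
      \<le> enn2ereal (\<integral>\<^sup>+(x, y). ennreal (cost x y) \<partial>\<gamma>)"
    by (simp add: case_prod_unfold)
qed

text \<open>The map that sends each cell to its point couples \<open>u\<^sub>d\<close> with the cell masses, and on the graph of
  this map \<open>\<psi>\<^sup>c(x) + \<psi>(y) = c(x, y)\<close> almost everywhere.\<close>

lemma W2sq_u_tilde: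
  "W2sq D a ud (mass \<xi>) = ereal (semidual a ud \<xi> + potential a \<xi> \<bullet> mass \<xi>)"
proof (rule antisym)
  show "ereal (semidual a ud \<xi> + potential a \<xi> \<bullet> mass \<xi>) \<le> W2sq D a ud (mass \<xi>)"
    by (rule weak_duality)
next
  \<comment> \<open>Off the cells the value of \<open>T\<close> is an unspecified point of \<open>F\<close>; this concerns a null set only.\<close>
  define T where "T x = a (THE i. x \<in> cell D a \<xi> i)" for x
  have T_cell: "T x = a i" if "x \<in> cell D a \<xi> i" for x i
    unfolding T_def using that cell_unique[of x D a \<xi>] by (metis the_equality)
  have idx: "(\<lambda>x. THE i. x \<in> cell D a \<xi> i) \<in> ud \<rightarrow>\<^sub>M count_space UNIV"
    by (rule measurable_THE[where I = UNIV]) (auto dest: cell_unique)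
  have T_borel: "T \<in> borel_measurable ud"
    unfolding T_def by (rule measurable_compose[OF idx]) simp
  have T_meas: "T \<in> ud \<rightarrow>\<^sub>M restrict_space borel (range a)"
    by (rule measurable_restrict_space2[OF _ T_borel]) (auto simp: T_def)
  have id_borel: "(\<lambda>x. x) \<in> borel_measurable ud"
    by (rule measurable_ud) simp
  define H where "H x = (x, T x)" for x
  have "H \<in> ud \<rightarrow>\<^sub>M borel"
    unfolding H_def borel_prod[symmetric] by (rule measurable_Pair[OF id_borel T_borel])
  then have H_meas: "H \<in> ud \<rightarrow>\<^sub>M restrict_space borel (D \<times> range a)"
    by (intro measurable_restrict_space2) (auto simp: H_def T_def space_ud)
  define \<gamma> where "\<gamma> = distr ud (restrict_space borel (D \<times> range a)) H"
  have fst_meas: "fst \<in> restrict_space borel (D \<times> range a) \<rightarrow>\<^sub>M restrict_space borel D"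
    by (rule measurable_restrict_space2)
      (auto simp: space_restrict_space
        intro!: measurable_restrict_space1 borel_measurable_continuous_onI continuous_intros)
  have snd_meas: "snd \<in> restrict_space borel (D \<times> range a) \<rightarrow>\<^sub>M restrict_space borel (range a)"
    by (rule measurable_restrict_space2)
      (auto simp: space_restrict_space
        intro!: measurable_restrict_space1 borel_measurable_continuous_onI continuous_intros)
  define h where "h x = pot_conj \<xi> x + (\<Sum>i\<in>UNIV. potential a \<xi> $ i * indicator (cell D a \<xi> i) x)" for x
  have integrable_h: "integrable ud h"
    unfolding h_def by (intro Bochner_Integration.integrable_add conj_integrable integral_sum_indicator_cell)
  have int_h: "(\<integral>x. h x \<partial>ud) = semidual a ud \<xi> + potential a \<xi> \<bullet> mass \<xi>"
    unfolding h_def Bochner_Integration.integral_add[OF conj_integrable integral_sum_indicator_cell(1)]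
      integral_sum_indicator_cell(2)
    by (simp add: semidual_def inner_vec_def)
  have h_eq: "AE x in ud. cost x (T x) = h x"
    using AE_in_cell[of \<xi>]
  proof eventually_elim
    case (elim x)
    then obtain i where i: "x \<in> cell D a \<xi> i"
      by blast
    then show ?case
      unfolding h_def sum_indicator_cell[OF i] c_conj_on_cell[OF inj i] T_cell[OF i] by simp
  qed
  have h_nonneg: "AE x in ud. 0 \<le> h x"
    using h_eq by eventually_elim (metis cost_def zero_le_power2)
  have "\<gamma> \<in> couplings D a ud (mass \<xi>)"
    unfolding couplings_def
  proof (intro CollectI conjI allI impI)
    show "sets \<gamma> = sets (restrict_space borel (D \<times> range a))"
      by (simp add: \<gamma>_def)
    have "fst \<circ> H = (\<lambda>x. x)"
      by (auto simp: H_def)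
    then show "distr \<gamma> (restrict_space borel D) fst = ud"
      unfolding \<gamma>_def distr_distr[OF fst_meas H_meas] by (simp add: distr_id2 sets_ud)
    fix B
    assume B: "B \<subseteq> range a"
    have sB: "B \<in> sets (restrict_space borel (range a))"
      using B by (subst sets_restrict_space_iff)
        (auto intro!: borel_closed[OF finite_imp_closed] finite_subset[OF B])
    have "snd \<circ> H = T"
      by (auto simp: H_def)
    then have "emeasure (distr \<gamma> (restrict_space borel (range a)) snd) B
        = emeasure ud (T -` B \<inter> space ud)"
      unfolding \<gamma>_def distr_distr[OF snd_meas H_meas] by (simp add: emeasure_distr[OF T_meas sB])
    moreover have "measure ud (T -` B \<inter> space ud) = signed_measure_of a (mass \<xi>) B"
    proof -
      have "measure ud (T -` B \<inter> space ud) = (\<integral>x. indicator (T -` B \<inter> space ud) x \<partial>ud)"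
        using measurable_sets[OF T_meas sB] by simp
      also have "\<dots> = (\<integral>x. (\<Sum>i\<in>UNIV. indicator B (a i) * indicator (cell D a \<xi> i) x) \<partial>ud)"
      proof (rule integral_cong_AE)
        show "AE x in ud. indicator (T -` B \<inter> space ud) x
            = (\<Sum>i\<in>UNIV. indicator B (a i) * indicator (cell D a \<xi> i) x :: real)"
          using AE_in_cell[of \<xi>] AE_space
        proof eventually_elim
          case (elim x)
          then obtain i where i: "x \<in> cell D a \<xi> i"
            by blast
          then show ?case
            unfolding sum_indicator_cell[OF i] using elim T_cell[OF i] by (auto simp: indicator_def)
        qed
      qed (use measurable_sets[OF T_meas sB] integral_sum_indicator_cell(1) in auto)
      also have "\<dots> = signed_measure_of a (mass \<xi>) B"
        unfolding integral_sum_indicator_cell(2) signed_measure_of_def by (simp only: mult.commute)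
      finally show ?thesis .
    qed
    ultimately show "enn2ereal (emeasure (distr \<gamma> (restrict_space borel (range a)) snd) B)
        = ereal (signed_measure_of a (mass \<xi>) B)"
      by (metis emeasure_eq_measure enn2ereal_ennreal measure_nonneg)
  qed
  then have "W2sq D a ud (mass \<xi>) \<le> enn2ereal (\<integral>\<^sup>+(x, y). ennreal (cost x y) \<partial>\<gamma>)"
    unfolding W2sq_def by (rule INF_lower)
  also have "(\<integral>\<^sup>+(x, y). ennreal (cost x y) \<partial>\<gamma>) = (\<integral>\<^sup>+x. ennreal (cost x (T x)) \<partial>ud)"
  proof -
    have "(\<lambda>z. ennreal (cost (fst z) (snd z))) \<in> borel_measurable (restrict_space borel (D \<times> range a))"
      unfolding cost_def
      by (intro measurable_restrict_space1 measurable_compose[OF _ measurable_ennreal]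
          borel_measurable_continuous_onI continuous_intros)
    then show ?thesis
      unfolding \<gamma>_def case_prod_unfold by (subst nn_integral_distr[OF H_meas]) (auto simp: H_def)
  qed
  also have "\<dots> = (\<integral>\<^sup>+x. ennreal (h x) \<partial>ud)"
    by (rule nn_integral_cong_AE) (use h_eq in eventually_elim, simp)
  also have "\<dots> = ennreal (semidual a ud \<xi> + potential a \<xi> \<bullet> mass \<xi>)"
    unfolding int_h[symmetric] by (rule nn_integral_eq_integral[OF integrable_h h_nonneg])
  also have "enn2ereal \<dots> = ereal (semidual a ud \<xi> + potential a \<xi> \<bullet> mass \<xi>)"
    unfolding int_h[symmetric] by (rule enn2ereal_ennreal[OF integral_nonneg_AE[OF h_nonneg]])
  finally show "W2sq D a ud (mass \<xi>) \<le> ereal (semidual a ud \<xi> + potential a \<xi> \<bullet> mass \<xi>)" .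
qed

text \<open>By weak duality an optimal potential for \<open>u\<close> maximises the dual functional
  \<open>\<xi> \<mapsto> semidual \<xi> + potential \<xi> \<bullet> u\<close>; as the second summand is affine in \<open>\<xi>\<close> with slope \<open>-2u\<close>, this means
  that \<open>2u\<close> is a supergradient of the semidual. The converse is attainment by the cell map.\<close>

lemma potential_optimal_iff:
  "fun_of_vec a (potential a \<xi>) \<in> kantorovich_potentials D a ud u \<longleftrightarrow> u = mass \<xi>"
proof -
  have dual: "(\<Sum>i\<in>UNIV. fun_of_vec a (potential a \<xi>) (a i) * u $ i) = potential a \<xi> \<bullet> u" for u
    by (simp add: fun_of_vec_apply[OF inj] inner_vec_def)
  have opt: "fun_of_vec a (potential a \<xi>) \<in> kantorovich_potentials D a ud u
      \<longleftrightarrow> ereal (semidual a ud \<xi> + potential a \<xi> \<bullet> u) = W2sq D a ud u"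
    unfolding kantorovich_potentials_def
    by (simp add: fun_of_vec_C_space dual semidual_def)
  show ?thesis
    unfolding opt
  proof
    assume eq: "ereal (semidual a ud \<xi> + potential a \<xi> \<bullet> u) = W2sq D a ud u"
    show "u = mass \<xi>"
    proof (rule supergradient_unique)
      fix \<zeta>
      have "ereal (semidual a ud \<zeta> + potential a \<zeta> \<bullet> u) \<le> ereal (semidual a ud \<xi> + potential a \<xi> \<bullet> u)"
        unfolding eq by (rule weak_duality)
      then have "semidual a ud \<zeta> \<le> semidual a ud \<xi> + (potential a \<xi> - potential a \<zeta>) \<bullet> u"
        by (simp add: inner_diff_left)
      also have "potential a \<xi> - potential a \<zeta> = 2 *\<^sub>R (\<zeta> - \<xi>)"
        by (simp add: potential_def vec_eq_iff)
      finally show "semidual a ud \<zeta> \<le> semidual a ud \<xi> + 2 * ((\<zeta> - \<xi>) \<bullet> u)"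
        by simp
    qed
  next
    assume "u = mass \<xi>"
    then show "ereal (semidual a ud \<xi> + potential a \<xi> \<bullet> u) = W2sq D a ud u"
      by (simp add: W2sq_u_tilde)
  qed
qed

section \<open>Zeros of the residual\<close>

text \<open>The masses range over a compact box, so the map \<open>\<xi> \<mapsto> r(\<xi>) + \<xi>\<close>, which sees \<open>\<xi>\<close> only through them, is
  bounded and sends some ball into itself.\<close>

lemma residual_zero_exists:
  assumes "continuous_on UNIV (gradient g)"
  shows "\<exists>\<xi>. residual D a ud \<alpha> g \<xi> = 0"
proof -
  define f where "f u = (1 / 2) *\<^sub>R (\<chi> i. (norm (a i))\<^sup>2) + (1 / \<alpha>) *\<^sub>R gradient g u" for u
  let ?K = "cbox 0 (\<chi> i. measure ud (space ud)) :: (real^'n) set"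
  have cont: "continuous_on UNIV f"
    unfolding f_def by (intro continuous_intros assms)
  have mass_K: "mass \<xi> \<in> ?K" for \<xi>
    by (simp add: mem_box_cart u_tilde_def bounded_measure)
  have "compact (f ` ?K)"
    by (intro compact_continuous_image compact_cbox continuous_on_subset[OF cont]) simp
  then obtain R where R: "\<And>u. u \<in> ?K \<Longrightarrow> norm (f u) \<le> R" and "R > 0"
    using compact_imp_bounded[of "f ` ?K"] unfolding bounded_pos by blast
  obtain \<xi> where "f (mass \<xi>) = \<xi>"
  proof (rule brouwer[of "cball 0 R" "\<lambda>\<xi>. f (mass \<xi>)"])
    show "continuous_on (cball 0 R) (\<lambda>\<xi>. f (mass \<xi>))"
      by (rule continuous_on_compose2[OF cont continuous_on_subset[OF continuous_mass]]) auto
    show "(\<lambda>\<xi>. f (mass \<xi>)) \<in> cball 0 R \<rightarrow> cball 0 R"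
      using R mass_K by auto
  qed (use \<open>R > 0\<close> in auto)
  then show ?thesis
    unfolding residual_def f_def by (metis right_minus_eq)
qed

lemma residual_zero_iff:
  assumes "\<alpha> \<noteq> 0"
  shows "residual D a ud \<alpha> g \<xi> = 0 \<longleftrightarrow> potential a \<xi> = - (2 / \<alpha>) *\<^sub>R gradient g (mass \<xi>)"
  using assms by (auto simp: residual_def potential_def vec_eq_iff field_simps)

text \<open>Solving \<open>r(\<xi>) = 0\<close> for \<open>\<xi>\<close> with the masses \<open>u\<close> prescribed leaves a single candidate, and its
  potential is \<open>-(2/\<alpha>) g'(u)\<close>.\<close>

lemma OC_iff:
  assumes "\<alpha> \<noteq> 0"
  shows "OC D a ud \<alpha> g u \<longleftrightarrow> (\<exists>\<xi>. u = mass \<xi> \<and> residual D a ud \<alpha> g \<xi> = 0)"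
proof -
  define \<xi> where "\<xi> = (1 / 2) *\<^sub>R (\<chi> i. (norm (a i))\<^sup>2) + (1 / \<alpha>) *\<^sub>R gradient g u"
  have "potential a \<xi> = - (2 / \<alpha>) *\<^sub>R gradient g u"
    by (simp add: \<xi>_def potential_def vec_eq_iff)
  then have "OC D a ud \<alpha> g u \<longleftrightarrow> u = mass \<xi>"
    using potential_optimal_iff[of \<xi> u] unfolding OC_def by simp
  moreover have "\<zeta> = \<xi>" if "u = mass \<zeta>" "residual D a ud \<alpha> g \<zeta> = 0" for \<zeta>
    using that by (simp add: residual_def \<xi>_def)
  moreover have "residual D a ud \<alpha> g \<xi> = 0" if "u = mass \<xi>"
    using that[symmetric] by (simp add: residual_def \<xi>_def)
  ultimately show ?thesis
    by blast
qed

lemma residual_zero_unique: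
  assumes "\<alpha> > 0" "convex_on UNIV g" "\<And>x. g differentiable (at x)"
    and \<xi>: "residual D a ud \<alpha> g \<xi> = 0" and \<zeta>: "residual D a ud \<alpha> g \<zeta> = 0"
  shows "\<xi> = \<zeta>"
proof -
  let ?d = "gradient g (mass \<xi>) - gradient g (mass \<zeta>)"
  have "\<xi> - \<zeta> = (1 / \<alpha>) *\<^sub>R ?d - (residual D a ud \<alpha> g \<xi> - residual D a ud \<alpha> g \<zeta>)"
    by (simp add: residual_def scaleR_diff_right)
  then have diff: "\<xi> - \<zeta> = (1 / \<alpha>) *\<^sub>R ?d"
    by (simp add: \<xi> \<zeta>)
  have "gradient g (mass \<xi>) \<bullet> (mass \<zeta> - mass \<xi>) \<le> g (mass \<zeta>) - g (mass \<xi>)"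
    "gradient g (mass \<zeta>) \<bullet> (mass \<xi> - mass \<zeta>) \<le> g (mass \<xi>) - g (mass \<zeta>)"
    using assms by (auto intro: convex_on_above_gradient)
  then have "0 \<le> ?d \<bullet> (mass \<xi> - mass \<zeta>)"
    by (simp add: inner_diff)
  then have "0 \<le> (\<xi> - \<zeta>) \<bullet> (mass \<xi> - mass \<zeta>)"
    unfolding diff using \<open>\<alpha> > 0\<close> by simp
  then have "mass \<xi> = mass \<zeta>"
    by (rule mass_eq_if_monotone)
  then show ?thesis
    using diff by simp
qed

text \<open>The zero's potential is dual feasible for every competitor, so the transport cost lies above an
  affine function of the masses whose slope cancels that of the tangent of \<open>g\<close>.\<close>

lemma residual_zero_minimizes:
  assumes "\<alpha> > 0" "convex_on UNIV g" "\<And>x. g differentiable (at x)"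
    and \<xi>: "residual D a ud \<alpha> g \<xi> = 0"
  shows "objective D a ud \<alpha> g \<xi> \<le> objective D a ud \<alpha> g \<zeta>"
proof -
  let ?u = "mass \<xi>" and ?v = "mass \<zeta>" and ?p = "potential a \<xi>"
  have p: "(\<alpha> / 2) *\<^sub>R ?p = - gradient g ?u"
    using \<xi> \<open>\<alpha> > 0\<close> by (simp add: residual_zero_iff)
  have "(\<alpha> / 2) * (?p \<bullet> ?v) - (\<alpha> / 2) * (?p \<bullet> ?u) = - (gradient g ?u \<bullet> (?v - ?u))"
    unfolding inner_minus_left[symmetric] p[symmetric] by (simp add: inner_diff_right right_diff_distrib)
  moreover have "gradient g ?u \<bullet> (?v - ?u) \<le> g ?v - g ?u"
    using assms by (intro convex_on_above_gradient) auto
  ultimately have "g ?u + \<alpha> / 2 * (semidual a ud \<xi> + ?p \<bullet> ?u)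
      \<le> g ?v + \<alpha> / 2 * (semidual a ud \<xi> + ?p \<bullet> ?v)"
    by (simp add: algebra_simps)
  then have "objective D a ud \<alpha> g \<xi>
      \<le> ereal (g ?v) + ereal (\<alpha> / 2) * ereal (semidual a ud \<xi> + ?p \<bullet> ?v)"
    unfolding objective_def W2sq_u_tilde by simp
  also have "\<dots> \<le> objective D a ud \<alpha> g \<zeta>"
    unfolding objective_def using \<open>\<alpha> > 0\<close>
    by (intro add_left_mono ereal_mult_left_mono weak_duality) simp
  finally show ?thesis .
qed

end

section \<open>Measures with a continuous density\<close>

lemma semidiscrete_density:
  fixes a :: "'n::finite \<Rightarrow> real^2" and \<rho> :: "real^2 \<Rightarrow> real"
  assumes "inj a" and D: "compact D" "convex D" and \<rho>: "continuous_on D \<rho>"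
  shows "semidiscrete (density (restrict_space lborel D) (\<lambda>x. ennreal (\<rho> x))) a D"
    (is "semidiscrete ?ud a D")
proof -
  have D_borel: "D \<in> sets lborel"
    using D by (simp add: borel_compact)
  have sets_eq: "sets (restrict_space lborel D) = sets (restrict_space borel D)"
    by (rule sets_restrict_space_cong) simp
  have "\<rho> \<in> borel_measurable (restrict_space lborel D)"
    using borel_measurable_continuous_on_restrict[OF \<rho>] measurable_cong_sets[OF sets_eq refl] by blast
  then have \<rho>_meas: "(\<lambda>x. ennreal (\<rho> x)) \<in> borel_measurable (restrict_space lborel D)"
    by simp
  have space_eq: "space (restrict_space lborel D) = D"
    by (simp add: space_restrict_space)
  have D_sets: "D \<in> sets (restrict_space lborel D)"
    using sets.top[of "restrict_space lborel D"] unfolding space_eq .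
  obtain B where B: "\<And>x. x \<in> D \<Longrightarrow> \<rho> x \<le> B"
    using compact_imp_bounded[OF compact_continuous_image[OF \<rho> D(1)]]
    unfolding bounded_iff by (force intro: order_trans[OF abs_ge_self])
  interpret finite_measure ?ud
  proof
    have "emeasure ?ud (space ?ud) = (\<integral>\<^sup>+x. ennreal (\<rho> x) * indicator D x \<partial>restrict_space lborel D)"
      using D_sets by (simp add: space_eq emeasure_density[OF \<rho>_meas])
    also have "\<dots> \<le> (\<integral>\<^sup>+x. ennreal B \<partial>restrict_space lborel D)"
      by (rule nn_integral_mono) (auto simp: space_eq indicator_def intro!: ennreal_leI B)
    also have "\<dots> = ennreal B * emeasure lborel D"
      using D_borel by (simp add: space_eq emeasure_restrict_space[of D lborel])
    also have "\<dots> < \<infinity>"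
      using emeasure_compact_finite[OF D(1)] by (simp add: ennreal_mult_less_top)
    finally show "emeasure ?ud (space ?ud) \<noteq> \<infinity>"
      by simp
  qed
  show ?thesis
  proof
    fix N :: "(real^2) set"
    assume "negligible N"
    then have "AE x in lebesgue. x \<notin> N"
      by (auto simp: negligible_iff_null_sets intro: AE_not_in)
    then have "AE x in lborel. x \<notin> N"
      by (simp add: AE_completion_iff)
    then have "AE x in restrict_space lborel D. x \<notin> N"
      by (subst AE_restrict_space_iff) (use D_borel in auto)
    then show "AE x in ?ud. x \<notin> N"
      by (subst AE_density[OF \<rho>_meas]) auto
  qed (use assms sets_eq in auto)
qed

section \<open>Optimality conditions\<close>

theorem theorem2p6:
  fixes a :: "'n::finite \<Rightarrow> real^2"
    and D :: "(real^2) set"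
    and ud :: "(real^2) measure"
    and \<rho> :: "real^2 \<Rightarrow> real"
    and \<alpha> :: real
    and g :: "real^'n \<Rightarrow> real"
  assumes "inj a"
    and "polytope D" and "interior D \<noteq> {}"
    and "continuous_on D \<rho>" and "\<And>x. x \<in> D \<Longrightarrow> 0 \<le> \<rho> x"
    and "ud = density (restrict_space lborel D) (\<lambda>x. ennreal (\<rho> x))"
    and "0 < \<alpha>"
    and "twice_continuously_differentiable g"
  shows "(\<forall>u. OC D a ud \<alpha> g u \<longrightarrow>
            (\<exists>!\<xi>. u = u_tilde D a ud \<xi> \<and> residual D a ud \<alpha> g \<xi> = 0)) \<and>
         (\<forall>\<xi>. residual D a ud \<alpha> g \<xi> = 0 \<longrightarrow> OC D a ud \<alpha> g (u_tilde D a ud \<xi>)) \<and>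
         (convex_on UNIV g \<longrightarrow>
            (\<exists>!\<xi>. residual D a ud \<alpha> g \<xi> = 0) \<and>
            (\<forall>\<xi>. residual D a ud \<alpha> g \<xi> = 0 \<longrightarrow>
                 (\<forall>\<zeta>. objective D a ud \<alpha> g \<xi> \<le> objective D a ud \<alpha> g \<zeta>)))"
proof -
  have "semidiscrete ud a D"
    unfolding \<open>ud = _\<close> using assms
    by (intro semidiscrete_density polytope_imp_compact polytope_imp_convex)
  then interpret semidiscrete ud a D .
  have diff: "\<And>x. g differentiable (at x)"
    and cont: "continuous_on UNIV (gradient g)"
    using assms(8) unfolding twice_continuously_differentiable_def
    by (auto simp: continuous_on_eq_continuous_at differentiable_imp_continuous_within)
  have OC: "OC D a ud \<alpha> g u \<longleftrightarrow> (\<exists>\<xi>. u = mass \<xi> \<and> residual D a ud \<alpha> g \<xi> = 0)" for u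
    using \<open>0 < \<alpha>\<close> by (intro OC_iff) simp
  have unique: "\<xi> = \<zeta>"
    if "mass \<xi> = mass \<zeta>" "residual D a ud \<alpha> g \<xi> = 0" "residual D a ud \<alpha> g \<zeta> = 0" for \<xi> \<zeta>
    using that by (simp add: residual_def)
  show ?thesis
  proof (intro conjI allI impI)
    fix u
    assume "OC D a ud \<alpha> g u"
    then obtain \<xi> where "u = mass \<xi>" "residual D a ud \<alpha> g \<xi> = 0"
      unfolding OC by blast
    then show "\<exists>!\<xi>. u = mass \<xi> \<and> residual D a ud \<alpha> g \<xi> = 0"
      by (intro ex1I[of _ \<xi>]) (auto intro: unique)
  next
    fix \<xi>
    assume "residual D a ud \<alpha> g \<xi> = 0"
    then show "OC D a ud \<alpha> g (mass \<xi>)"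
      unfolding OC by blast
  next
    assume "convex_on UNIV g"
    then show "\<exists>!\<xi>. residual D a ud \<alpha> g \<xi> = 0"
      using residual_zero_exists[OF cont] residual_zero_unique[OF \<open>0 < \<alpha>\<close> _ diff] by blast
  next
    fix \<xi> \<zeta>
    assume "convex_on UNIV g" "residual D a ud \<alpha> g \<xi> = 0"
    then show "objective D a ud \<alpha> g \<xi> \<le> objective D a ud \<alpha> g \<zeta>"
      using residual_zero_minimizes[OF \<open>0 < \<alpha>\<close> _ diff] by blast
  qed
qed

end
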